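(* Let $(\mathcal G,\mathcal Y_{\mathcal V},\theta)$ be a binary graphical model with local polytope $\mathcal L$, and let $\mu'\in\arg\min_{\mu\in\mathcal L}\langle\theta,\mu\rangle$ be a solution of the relaxed MAP-inference problem. Let $\mathrm{Int}(\mu')=\{u\in\mathcal V:\mu'_u\in\{0,1\}^2\}$ and let $y'\in\{0,1\}^{\mathrm{Int}(\mu')}$ be the partial labeling with $\mu'_u(y'_u)=1$ for all $u\in\mathrm{Int}(\mu')$. Then $y'$ (that is, $\mu'|_{\mathrm{Int}(\mu')}$) is persistent: there exists $y^*\in\arg\min_{y\in\mathcal Y_{\mathcal V}}E(y;\theta)$ such that $y^*_u=y'_u$ for all $u\in\mathrm{Int}(\mu')$.
   Context: Let $\mathcal G=(\mathcal V,\mathcal E)$ be a finite simple undirected graph, $\mathcal Y_u=\{0,1\}$ for every $u\in\mathcal V$, $\mathcal Y_{uv}=\{0,1\}^2$ for $uv\in\mathcal E$, $\mathcal Y_{\mathcal V}=\{0,1\}^{\mathcal V}$. The real cost vector $\theta$ has coordinates $\theta_u(s)$ and $\theta_{uv}(s,t)$ (arbitrary reals), and the energy is $E(y;\theta)=\sum_{u\in\mathcal V}\theta_u(y_u)+\sum_{uv\in\mathcal E}\theta_{uv}(y_u,y_v)$. The local polytope $\mathcal L$ is the set of vectors $\mu$ indexed like $\theta$ such that each $\mu_u$ and each $\mu_{uv}$ is a probability vector (non-negative entries summing to $1$), and $\sum_{t}\mu_{uv}(s,t)=\mu_u(s)$, $\sum_s\mu_{uv}(s,t)=\mu_v(t)$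 for all $uv\in\mathcal E$ and $s,t\in\{0,1\}$. *)

theory Defs
  imports "HOL-Library.FuncSet" Complex_Main
begin

text \<open>
  The label set \<open>{0,1}\<close> is the type \<^typ>\<open>bool\<close> (\<open>0\<close> is \<^const>\<open>False\<close>, \<open>1\<close> is \<^const>\<open>True\<close>).
  Edges are unordered two-element vertex sets. To give the two arguments of
  \<open>\<theta>\<^sub>u\<^sub>v(s,t)\<close> a meaning, \<open>ends e = (u,v)\<close> fixes, arbitrarily, which way round the
  undirected edge \<open>e = {u,v}\<close> is written as \<open>uv\<close>: then \<open>s\<close> is the label of \<open>u\<close> and
  \<open>t\<close> the label of \<open>v\<close>.
\<close>

locale binary_graphical_model =
  fixes V :: "'v set" and E :: "'v set set" and ends :: "'v set \<Rightarrow> 'v \<times> 'v"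
  assumes finite_vertices: "finite V"
    and simple_edges: "\<And>e. e \<in> E \<Longrightarrow> e \<subseteq> V \<and> card e = 2"
    and edge_ends: "\<And>e u v. e \<in> E \<Longrightarrow> ends e = (u, v) \<Longrightarrow> e = {u, v}"

text \<open>
  Coordinates shared by cost vectors \<open>\<theta>\<close> and relaxed labelings \<open>\<mu>\<close>. Only the
  coordinates in \<open>coords V E\<close> below are meaningful; values elsewhere play no role.
\<close>

datatype 'v coord = Node 'v bool | Edge "'v set" bool bool

type_synonym 'v vec = "'v coord \<Rightarrow> real"

definition coords :: "'v set \<Rightarrow> 'v set set \<Rightarrow> 'v coord set" where
  "coords V E = {Node u s | u s. u \<in> V} \<union> {Edge e s t | e s t. e \<in> E}"

definition inner_coords :: "'v set \<Rightarrow> 'v set set \<Rightarrow> 'v vec \<Rightarrow> 'v vec \<Rightarrow> real" where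
  "inner_coords V E \<theta> \<mu> = (\<Sum>i\<in>coords V E. \<theta> i * \<mu> i)"

definition labelings :: "'v set \<Rightarrow> ('v \<Rightarrow> bool) set" where
  "labelings A = A \<rightarrow>\<^sub>E UNIV"

definition energy ::
    "'v set \<Rightarrow> 'v set set \<Rightarrow> ('v set \<Rightarrow> 'v \<times> 'v) \<Rightarrow> 'v vec \<Rightarrow> ('v \<Rightarrow> bool) \<Rightarrow> real" where
  "energy V E ends \<theta> y =
     (\<Sum>u\<in>V. \<theta> (Node u (y u))) +
     (\<Sum>e\<in>E. case ends e of (u, v) \<Rightarrow> \<theta> (Edge e (y u) (y v)))"

definition local_polytope ::
    "'v set \<Rightarrow> 'v set set \<Rightarrow> ('v set \<Rightarrow> 'v \<times> 'v) \<Rightarrow> 'v vec set" where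
  "local_polytope V E ends = {\<mu>.
     (\<forall>u\<in>V. (\<forall>s. 0 \<le> \<mu> (Node u s)) \<and> (\<Sum>s\<in>UNIV. \<mu> (Node u s)) = 1) \<and>
     (\<forall>e\<in>E. (\<forall>s t. 0 \<le> \<mu> (Edge e s t)) \<and> (\<Sum>s\<in>UNIV. \<Sum>t\<in>UNIV. \<mu> (Edge e s t)) = 1) \<and>
     (\<forall>e\<in>E. case ends e of (u, v) \<Rightarrow>
        (\<forall>s. (\<Sum>t\<in>UNIV. \<mu> (Edge e s t)) = \<mu> (Node u s)) \<and>
        (\<forall>t. (\<Sum>s\<in>UNIV. \<mu> (Edge e s t)) = \<mu> (Node v t)))}"

definition integral_nodes :: "'v set \<Rightarrow> 'v vec \<Rightarrow> 'v set" where
  "integral_nodes V \<mu> = {u \<in> V. \<forall>s. \<mu> (Node u s) \<in> {0, 1}}"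

definition persistent ::
    "'v set \<Rightarrow> 'v set set \<Rightarrow> ('v set \<Rightarrow> 'v \<times> 'v) \<Rightarrow> 'v vec \<Rightarrow> 'v set \<Rightarrow> ('v \<Rightarrow> bool) \<Rightarrow> bool" where
  "persistent V E ends \<theta> A y' \<longleftrightarrow>
     (\<exists>y. is_arg_min (energy V E ends \<theta>) (\<lambda>y. y \<in> labelings V) y \<and> (\<forall>u\<in>A. y u = y' u))"

end

theory Submission
  imports Defs
begin

text \<open>
  Let \<open>y\<close> be an optimal labeling and let \<open>z\<close> agree with \<open>y'\<close> on the integral nodes and with
  \<open>y\<close> elsewhere. The difference of the integral points of \<open>\<L>\<close> representing \<open>y\<close> and \<open>z\<close> is
  a feasible direction at \<open>\<mu>'\<close>: every coordinate that it decreases is the one selected by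
  \<open>z\<close> at a node or an edge touching an integral node, and there \<open>\<mu>'\<close> is positive, because it
  has mass \<open>1\<close> at the integral end and positive mass on both labels at any other end.
  Optimality of \<open>\<mu>'\<close> along this direction says that the energy of \<open>z\<close> is at most that of \<open>y\<close>.
\<close>

text \<open>The usual 0/1 indicator embedding of labelings. It turns the energy into a linear
  function, so labelings can serve as points and directions in the relaxation.\<close>

definition labeling_vec :: "('v set \<Rightarrow> 'v \<times> 'v) \<Rightarrow> ('v \<Rightarrow> bool) \<Rightarrow> 'v vec" where
  "labeling_vec ends y i = (case i of
     Node u s \<Rightarrow> of_bool (y u = s)
   | Edge e s t \<Rightarrow> (case ends e of (u, v) \<Rightarrow> of_bool (y u = s \<and> y v = t)))"

lemma labeling_vec_simps [simp]:
  "labeling_vec ends y (Node u s) = of_bool (y u = s)"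
  "labeling_vec ends y (Edge e s t) = of_bool (y (fst (ends e)) = s \<and> y (snd (ends e)) = t)"
  by (simp_all add: labeling_vec_def split: prod.splits)

lemma coords_eq_image:
  "coords V E = (\<lambda>(u, s). Node u s) ` (V \<times> UNIV) \<union> (\<lambda>(e, s, t). Edge e s t) ` (E \<times> UNIV \<times> UNIV)"
  by (simp add: coords_def set_eq_iff image_iff Bex_def) blast

lemma finite_coords: "finite V \<Longrightarrow> finite E \<Longrightarrow> finite (coords V E)"
  unfolding coords_eq_image by (intro finite_UnI finite_imageI finite_cartesian_product) auto

lemma sum_coords:
  assumes "finite V" "finite E"
  shows "(\<Sum>i\<in>coords V E. f i) =
    (\<Sum>u\<in>V. \<Sum>s\<in>UNIV. f (Node u s)) + (\<Sum>e\<in>E. \<Sum>s\<in>UNIV. \<Sum>t\<in>UNIV. f (Edge e s t))"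
proof -
  let ?N = "(\<lambda>(u, s). Node u s) ` (V \<times> UNIV)"
  let ?E = "(\<lambda>(e, s, t). Edge e s t) ` (E \<times> UNIV \<times> UNIV)"
  have "sum f (coords V E) = sum f ?N + sum f ?E"
    unfolding coords_eq_image using assms by (intro sum.union_disjoint) auto
  moreover have "sum f ?N = (\<Sum>u\<in>V. \<Sum>s\<in>UNIV. f (Node u s))"
    by (subst sum.reindex) (auto simp: inj_on_def sum.cartesian_product case_prod_beta')
  moreover have "sum f ?E = (\<Sum>e\<in>E. \<Sum>s\<in>UNIV. \<Sum>t\<in>UNIV. f (Edge e s t))"
    by (subst sum.reindex) (auto simp: inj_on_def sum.cartesian_product case_prod_beta')
  ultimately show ?thesis by simp
qed

lemma inner_coords_labeling_vec:
  assumes "finite V" "finite E"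
  shows "inner_coords V E \<theta> (labeling_vec ends y) = energy V E ends \<theta> y"
proof -
  have "(\<Sum>s\<in>UNIV. \<theta> (Node u s) * labeling_vec ends y (Node u s)) = \<theta> (Node u (y u))" for u
    by (cases "y u") (simp_all add: UNIV_bool)
  moreover have "(\<Sum>s\<in>UNIV. \<Sum>t\<in>UNIV. \<theta> (Edge e s t) * labeling_vec ends y (Edge e s t)) =
      (case ends e of (u, v) \<Rightarrow> \<theta> (Edge e (y u) (y v)))" for e
    by (cases "y (fst (ends e))"; cases "y (snd (ends e))")
      (simp_all add: UNIV_bool case_prod_beta)
  ultimately show ?thesis
    unfolding inner_coords_def energy_def sum_coords[OF assms] by simp
qed

lemma inner_coords_add_scaled_diff:
  "inner_coords V E \<theta> (\<lambda>i. \<mu> i + c * (\<nu> i - \<rho> i)) =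
    inner_coords V E \<theta> \<mu> + c * (inner_coords V E \<theta> \<nu> - inner_coords V E \<theta> \<rho>)"
proof -
  have "\<theta> i * (\<mu> i + c * (\<nu> i - \<rho> i)) = \<theta> i * \<mu> i + c * (\<theta> i * \<nu> i - \<theta> i * \<rho> i)" for i
    by (simp add: algebra_simps)
  then show ?thesis
    by (simp add: inner_coords_def sum.distrib sum_subtractf flip: sum_distrib_left)
qed

lemma labeling_vec_in_local_polytope: "labeling_vec ends y \<in> local_polytope V E ends"
proof -
  have "(\<Sum>s\<in>UNIV. labeling_vec ends y (Node u s)) = 1" for u
    by (cases "y u") (simp_all add: UNIV_bool)
  moreover have "(\<Sum>t\<in>UNIV. labeling_vec ends y (Edge e s t)) =
      labeling_vec ends y (Node (fst (ends e)) s)" for e s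
    by (cases "y (snd (ends e))") (simp_all add: UNIV_bool)
  moreover have "(\<Sum>s\<in>UNIV. labeling_vec ends y (Edge e s t)) =
      labeling_vec ends y (Node (snd (ends e)) t)" for e t
    by (cases "y (fst (ends e))") (simp_all add: UNIV_bool)
  ultimately show ?thesis
    by (simp add: local_polytope_def case_prod_beta del: labeling_vec_simps)
       (simp add: labeling_vec_def case_prod_beta split: coord.splits)
qed

lemma positive_min_step:
  fixes f :: "'a \<Rightarrow> real"
  assumes "finite A"
  obtains c where "c > 0" "\<And>i. i \<in> A \<Longrightarrow> f i > 0 \<Longrightarrow> c \<le> f i"
proof
  \<comment> \<open>Inserting \<open>1\<close> keeps the minimum defined and positive when no value
    of \<open>f\<close> on \<open>A\<close> is positive.\<close>
  let ?S = "insert 1 (f ` {i \<in> A. f i > 0})"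
  have fin: "finite ?S" using assms by simp
  show "Min ?S > 0" using fin by (subst Min_gr_iff) auto
  show "Min ?S \<le> f i" if "i \<in> A" "f i > 0" for i
    using that fin by (intro Min_le) auto
qed

context binary_graphical_model
begin

lemma finite_edges: "finite E"
  using finite_vertices simple_edges by (auto intro: finite_subset[of E "Pow V"])

lemma ends_in_vertices:
  assumes "e \<in> E"
  shows "fst (ends e) \<in> V" "snd (ends e) \<in> V"
proof -
  have "e = {fst (ends e), snd (ends e)}" using edge_ends[OF assms] by (metis prod.collapse)
  with simple_edges[OF assms] have "{fst (ends e), snd (ends e)} \<subseteq> V" by metis
  then show "fst (ends e) \<in> V" "snd (ends e) \<in> V" by simp_all
qed

lemma Edge_marginals:
  assumes "\<mu> \<in> local_polytope V E ends" "e \<in> E" "ends e = (u, v)"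
  shows "(\<Sum>t\<in>UNIV. \<mu> (Edge e s t)) = \<mu> (Node u s)"
    and "(\<Sum>s\<in>UNIV. \<mu> (Edge e s t)) = \<mu> (Node v t)"
  using assms by (auto simp: local_polytope_def)

text \<open>Inclusion-exclusion: the two marginals count (s,t) twice and miss only the pair with
  both labels flipped. As the total mass is 1 and the missed mass is non-negative, \<mu>(s,t) is at
  least the sum of the two node masses minus 1.\<close>

lemma Edge_pos_if_ends_sum_gt_1:
  assumes "\<mu> \<in> local_polytope V E ends" "e \<in> E"
    and "\<mu> (Node (fst (ends e)) s) + \<mu> (Node (snd (ends e)) t) > 1"
  shows "\<mu> (Edge e s t) > 0"
proof -
  obtain u v where uv: "ends e = (u, v)" by fastforce
  have nonneg: "\<mu> (Edge e s' t') \<ge> 0" for s' t'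
    using assms(1,2) by (simp add: local_polytope_def)
  have total: "(\<Sum>s'\<in>UNIV. \<Sum>t'\<in>UNIV. \<mu> (Edge e s' t')) = 1"
    using assms(1,2) by (simp add: local_polytope_def)
  from Edge_marginals(1)[OF assms(1,2) uv, of s] Edge_marginals(2)[OF assms(1,2) uv, of t]
    total assms(3) uv nonneg[of "\<not> s" "\<not> t"]
  show ?thesis
    by (cases s; cases t) (simp_all add: UNIV_bool)
qed

text \<open>With only two labels, zero mass on one forces mass 1 on the other, which would make the
  node integral.\<close>

lemma Node_pos_if_not_integral:
  assumes "\<mu> \<in> local_polytope V E ends" "u \<in> V" "u \<notin> integral_nodes V \<mu>"
  shows "\<mu> (Node u s) > 0"
proof (rule ccontr)
  have nonneg: "\<mu> (Node u s') \<ge> 0" for s'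
    using assms(1,2) by (simp add: local_polytope_def)
  have total: "(\<Sum>s'\<in>UNIV. \<mu> (Node u s')) = 1"
    using assms(1,2) by (simp add: local_polytope_def)
  assume "\<not> \<mu> (Node u s) > 0"
  with nonneg[of s] have zero: "\<mu> (Node u s) = 0" by simp
  with total have "\<mu> (Node u (\<not> s)) = 1" by (cases s) (simp_all add: UNIV_bool)
  with zero have "\<mu> (Node u s') \<in> {0, 1}" for s' by (cases s; cases s') auto
  with assms(2,3) show False unfolding integral_nodes_def by blast
qed

text \<open>
  The equality constraints hold for every step length, so only non-negativity needs a hypothesis.
\<close>

lemma local_polytope_step:
  assumes in_polytope: "\<mu> \<in> local_polytope V E ends" "\<nu> \<in> local_polytope V E ends"
      "\<rho> \<in> local_polytope V E ends"
    and nonneg: "\<And>i. i \<in> coords V E \<Longrightarrow> \<mu> i + c * (\<nu> i - \<rho> i) \<ge> 0"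
  shows "(\<lambda>i. \<mu> i + c * (\<nu> i - \<rho> i)) \<in> local_polytope V E ends" (is "?\<kappa> \<in> _")
proof -
  \<comment> \<open>Leaving \<open>f\<close> general lets one identity serve the node sums and both
    edge marginals.\<close>
  have sum_step: "(\<Sum>s\<in>UNIV. ?\<kappa> (f s)) =
      (\<Sum>s\<in>UNIV. \<mu> (f s)) + c * ((\<Sum>s\<in>UNIV. \<nu> (f s)) - (\<Sum>s\<in>UNIV. \<rho> (f s)))"
    for f :: "bool \<Rightarrow> 'v coord"
    by (simp add: UNIV_bool algebra_simps)
  have "?\<kappa> (Node u s) \<ge> 0" if "u \<in> V" for u s
    using nonneg[of "Node u s"] that by (auto simp: coords_def)
  moreover have node_sum: "(\<Sum>s\<in>UNIV. ?\<kappa> (Node u s)) = 1" if "u \<in> V" for u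
    unfolding sum_step using in_polytope that by (simp add: local_polytope_def)
  moreover have "?\<kappa> (Edge e s t) \<ge> 0" if "e \<in> E" for e s t
    using nonneg[of "Edge e s t"] that by (auto simp: coords_def)
  moreover have marginals: "(\<Sum>t\<in>UNIV. ?\<kappa> (Edge e s t)) = ?\<kappa> (Node u s)"
      "(\<Sum>s\<in>UNIV. ?\<kappa> (Edge e s t)) = ?\<kappa> (Node v t)"
    if "e \<in> E" "ends e = (u, v)" for e u v s t
    unfolding sum_step using in_polytope that by (simp_all add: Edge_marginals)
  moreover have "(\<Sum>s\<in>UNIV. \<Sum>t\<in>UNIV. ?\<kappa> (Edge e s t)) = 1" if "e \<in> E" for e
    using marginals(1)[OF that] node_sum ends_in_vertices(1)[OF that] by (cases "ends e") simp
  ultimately show ?thesis unfolding local_polytope_def by (auto split: prod.splits)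
qed

text \<open>Moving from \<mu> by a small \<open>c > 0\<close> along the indicator of
  \<open>y\<close> minus that of \<open>z\<close> stays in the polytope and changes the objective by
  \<open>c\<close> times the energy of \<open>y\<close> minus the energy of \<open>z\<close>.
  Optimality of \<mu> makes this change non-negative.\<close>

lemma energy_le_if_positive_where_decreased:
  assumes opt: "is_arg_min (inner_coords V E \<theta>) (\<lambda>\<mu>. \<mu> \<in> local_polytope V E ends) \<mu>"
    and pos: "\<And>i. i \<in> coords V E \<Longrightarrow> labeling_vec ends y i < labeling_vec ends z i \<Longrightarrow> \<mu> i > 0"
  shows "energy V E ends \<theta> z \<le> energy V E ends \<theta> y"
proof -
  have \<mu>: "\<mu> \<in> local_polytope V E ends" using opt by (simp add: is_arg_min_def)
  obtain c where c: "c > 0" "\<And>i. i \<in> coords V E \<Longrightarrow> \<mu> i > 0 \<Longrightarrow> c \<le> \<mu> i"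
    using positive_min_step[OF finite_coords[OF finite_vertices finite_edges]] by metis
  let ?\<nu> = "\<lambda>i. \<mu> i + c * (labeling_vec ends y i - labeling_vec ends z i)"
  have "?\<nu> i \<ge> 0" if i: "i \<in> coords V E" for i
  proof -
    have "\<mu> i \<ge> 0" using i \<mu> by (auto simp: coords_def local_polytope_def)
    \<comment> \<open>A decreased coordinate loses exactly \<open>c\<close>, and there
      \<open>pos\<close> and the choice of \<open>c\<close> give c \<le> \<mu> i.\<close>
    moreover have "labeling_vec ends y i - labeling_vec ends z i \<in> {-1, 0, 1}"
      by (cases i) auto
    ultimately show ?thesis using c(1) c(2)[OF i] pos[OF i] by auto
  qed
  then have "?\<nu> \<in> local_polytope V E ends"
    using local_polytope_step[OF \<mu> labeling_vec_in_local_polytope labeling_vec_in_local_polytope]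
    by blast
  with opt have "inner_coords V E \<theta> \<mu> \<le> inner_coords V E \<theta> ?\<nu>"
    by (auto simp: is_arg_min_linorder)
  also have "\<dots> = inner_coords V E \<theta> \<mu> + c * (energy V E ends \<theta> y - energy V E ends \<theta> z)"
    by (simp add: inner_coords_add_scaled_diff
        inner_coords_labeling_vec[OF finite_vertices finite_edges])
  finally show ?thesis using c(1) by (simp add: zero_le_mult_iff)
qed

text \<open>What has to be checked is that \<mu> is positive wherever the overriding labeling
  \<open>z\<close> selects a coordinate that \<open>y\<close> does not. At nodes this is
  \<open>z_pos\<close>; an edge needs one end in the integral set.\<close>

lemma energy_override_integral_nodes_le:
  assumes opt: "is_arg_min (inner_coords V E \<theta>) (\<lambda>\<mu>. \<mu> \<in> local_polytope V E ends) \<mu>"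
    and one: "\<And>u. u \<in> integral_nodes V \<mu> \<Longrightarrow> \<mu> (Node u (x u)) = 1"
  shows "energy V E ends \<theta> (override_on y x (integral_nodes V \<mu>)) \<le> energy V E ends \<theta> y"
proof (rule energy_le_if_positive_where_decreased[OF opt])
  let ?A = "integral_nodes V \<mu>"
  let ?z = "override_on y x ?A"
  have \<mu>: "\<mu> \<in> local_polytope V E ends" using opt by (simp add: is_arg_min_def)
  have z_in: "\<mu> (Node u (?z u)) = 1" if "u \<in> ?A" for u using that one by simp
  have z_pos: "\<mu> (Node u (?z u)) > 0" if "u \<in> V" for u
    using that one Node_pos_if_not_integral[OF \<mu>, of u] by (cases "u \<in> ?A") simp_all
  fix i
  assume i: "i \<in> coords V E" and less: "labeling_vec ends y i < labeling_vec ends ?z i"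
  show "\<mu> i > 0"
  proof (cases i)
    case (Node u s)
    with i less z_pos show ?thesis by (auto simp: coords_def of_bool_def split: if_splits)
  next
    case (Edge e s t)
    let ?u = "fst (ends e)" and ?v = "snd (ends e)"
    have e: "e \<in> E" using i Edge by (auto simp: coords_def)
    have z: "?z ?u = s" "?z ?v = t" and ne: "\<not> (y ?u = s \<and> y ?v = t)"
      using less Edge by (auto simp: of_bool_def split: if_splits)
    \<comment> \<open>Otherwise \<open>z\<close> would agree with \<open>y\<close> at both ends, and
      \<open>y\<close> would select (s,t) too.\<close>
    then have "?u \<in> ?A \<or> ?v \<in> ?A" by (auto simp: override_on_def split: if_splits)
    \<comment> \<open>The integral end contributes exactly 1 and the other end a positive
      mass.\<close>
    then have "\<mu> (Node ?u s) + \<mu> (Node ?v t) > 1"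
      using z_in[of ?u] z_in[of ?v] z_pos ends_in_vertices[OF e] z by fastforce
    then show ?thesis using Edge Edge_pos_if_ends_sum_gt_1[OF \<mu> e] by simp
  qed
qed

end

theorem theorem12p3:
  fixes V :: "'v set" and E :: "'v set set" and ends :: "'v set \<Rightarrow> 'v \<times> 'v"
    and \<theta> \<mu>' :: "'v vec" and y' :: "'v \<Rightarrow> bool"
  assumes "binary_graphical_model V E ends"
    and "is_arg_min (inner_coords V E \<theta>) (\<lambda>\<mu>. \<mu> \<in> local_polytope V E ends) \<mu>'"
    and "y' \<in> labelings (integral_nodes V \<mu>')"
    and "\<forall>u\<in>integral_nodes V \<mu>'. \<mu>' (Node u (y' u)) = 1"
  shows "persistent V E ends \<theta> (integral_nodes V \<mu>') y'"
proof -
  interpret binary_graphical_model V E ends by fact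
  let ?A = "integral_nodes V \<mu>'"
  \<comment> \<open>There are finitely many labelings and at least one, so an optimal one
    exists.\<close>
  have "finite (labelings V)" "labelings V \<noteq> {}"
    using finite_vertices by (auto simp: labelings_def PiE_eq_empty_iff intro: finite_PiE)
  then obtain y where y: "is_arg_min (energy V E ends \<theta>) (\<lambda>y. y \<in> labelings V) y"
    using ex_is_arg_min_if_finite by metis
  let ?z = "override_on y y' ?A"
  \<comment> \<open>Overriding inside \<open>V\<close> leaves the value \<open>undefined\<close>
    outside \<open>V\<close> untouched, so \<open>z\<close> is still a member of
    \<open>labelings V\<close>.\<close>
  have "?A \<subseteq> V" by (auto simp: integral_nodes_def)
  with y have "?z \<in> labelings V"
    by (auto simp: is_arg_min_def labelings_def PiE_iff extensional_def override_on_def)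
  moreover have "energy V E ends \<theta> ?z \<le> energy V E ends \<theta> y"
    using energy_override_integral_nodes_le assms(2,4) by blast
  ultimately have "is_arg_min (energy V E ends \<theta>) (\<lambda>y. y \<in> labelings V) ?z"
    using y unfolding is_arg_min_linorder by (meson order_trans)
  then show ?thesis unfolding persistent_def by (auto intro!: exI[of _ ?z])
qed

end
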